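(* Let $f=\sum_{i=1}^m f_i$ with $f_i:\mathbb{R}^d\to\mathbb{R}$. Assume that: (i) each $f_i$ is convex and has $L$-Lipschitz continuous gradient, i.e. $f_i(x)+\langle\nabla f_i(x),y-x\rangle\le f_i(y)\le f_i(x)+\langle\nabla f_i(x),y-x\rangle+\frac L2\|y-x\|^2$ for all $x,y\in\mathbb{R}^d$; (ii) $f$ is $\mu$-strongly convex with $\mu>0$; (iii) $f_i(x)=\ell(a_i^Tx,b_i)$ with $a_i\in\mathbb{R}^d$, $b_i\in\mathbb{R}$, and $\mathrm{supp}(\nabla f_i(x))=\mathrm{supp}(a_i)$ for every $x$ and $i$. Let $\sigma=\min\big(\sqrt{m(1+\Delta_{\rm ave})},1+\Delta_{\max}\big)$. Let $Q$ be an unbiased random quantizer with variance parameter $\alpha$, and suppose $\gamma=1/(L\alpha(1+\theta)\sigma)$ for some $\theta>0$. Then the iterates generated by $$x_{k+1}=x_k-\gamma\sum_{i=1}^mQ(\nabla f_i(x_k))$$ satisfy, for all $k\in\mathbb{N}$, $$\mathbf{E}\|x_k-x^\star\|^2\le(1-\mu\gamma)^k\|x_0-x^\star\|^2+\frac1{\mu\theta L}\sum_{i=1}^m\|\nabla f_i(x^\star)\|^2.$$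
   Context: $\|\cdot\|$ is the Euclidean norm and $\mathrm{supp}(x)=\{i: x^i\ne0\}$. $x^\star$ is the minimizer of $f$. $x_0\in\mathbb{R}^d$ is a deterministic initial point. Conflict graph degrees: $\Delta_{\rm ave}=\frac1m\sum_{i=1}^m\sum_{j\ne i}\mathbf 1\{\mathrm{supp}(a_i)\cap\mathrm{supp}(a_j)\ne\emptyset\}$ and $\Delta_{\max}=\max_{i}\sum_{j\ne i}\mathbf 1\{\mathrm{supp}(a_i)\cap\mathrm{supp}(a_j)\ne\emptyset\}$. An unbiased random quantizer (URQ) with parameter $\alpha$ (finite, positive) is a random mapping $Q:\mathbb{R}^d\to\mathbb{R}^d$ such that for every $v\in\mathbb{R}^d$: $\mathrm{supp}(Q(v))\subseteq\mathrm{supp}(v)$, $\mathbf{E}\{Q(v)\}=v$, and $\mathbf{E}\{\|Q(v)\|^2\}\le\alpha\|v\|^2$. Each application of $Q$ in the algorithm uses fresh randomness, so these properties hold conditionally on the past iterates. *)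

theory Defs
  imports "HOL-Probability.Probability"
begin

definition supp :: "real ^ 'd \<Rightarrow> 'd set" where
  "supp v = {i. v $ i \<noteq> 0}"

definition grad :: "('a::euclidean_space \<Rightarrow> real) \<Rightarrow> 'a \<Rightarrow> 'a" where
  "grad F x = (THE g. GDERIV F x :> g)"

lemma grad_eqI:
  fixes F :: "'a::euclidean_space \<Rightarrow> real"
  assumes "GDERIV F x :> g"
  shows "grad F x = g"
  unfolding grad_def
proof (rule the_equality)
  show "GDERIV F x :> g" by (rule assms)
next
  fix g' assume "GDERIV F x :> g'"
  then have "(\<lambda>h. h \<bullet> g') = (\<lambda>h. h \<bullet> g)"
    using assms has_derivative_unique unfolding gderiv_def by blast
  then show "g' = g"
    by (metis inner_commute vector_eq_rdot)
qed

lemma GDERIV_grad: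
  fixes F :: "'a::euclidean_space \<Rightarrow> real"
  assumes "F differentiable (at x)"
  shows "GDERIV F x :> grad F x"
proof -
  obtain D where D: "(F has_derivative D) (at x)"
    using assms unfolding differentiable_def by blast
  then interpret bounded_linear D by (rule has_derivative_bounded_linear)
  have "D h = h \<bullet> adjoint D 1" for h
    using adjoint_works[OF linear_axioms, of h 1] by simp
  then have "D = (\<lambda>h. h \<bullet> adjoint D 1)" by blast
  then have "GDERIV F x :> adjoint D 1"
    using D unfolding gderiv_def by simp
  then show ?thesis
    using grad_eqI by metis
qed

text \<open>Convexity together with an \<open>L\<close>-Lipschitz continuous gradient, expressed by the usual
  lower and upper quadratic bounds around every point.\<close>

definition convex_smooth :: "real \<Rightarrow> ('a::euclidean_space \<Rightarrow> real) \<Rightarrow> bool" where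
  "convex_smooth L F \<longleftrightarrow>
     (\<forall>x. F differentiable (at x)) \<and>
     (\<forall>x y. F x + grad F x \<bullet> (y - x) \<le> F y \<and>
            F y \<le> F x + grad F x \<bullet> (y - x) + L / 2 * (norm (y - x))\<^sup>2)"

definition strongly_convex :: "real \<Rightarrow> ('a::euclidean_space \<Rightarrow> real) \<Rightarrow> bool" where
  "strongly_convex \<mu> F \<longleftrightarrow>
     (\<forall>x y. \<forall>t\<in>{0..1}. F (t *\<^sub>R x + (1 - t) *\<^sub>R y)
        \<le> t * F x + (1 - t) * F y - \<mu> / 2 * t * (1 - t) * (norm (x - y))\<^sup>2)"

definition conflict_degree :: "nat \<Rightarrow> (nat \<Rightarrow> real ^ 'd) \<Rightarrow> nat \<Rightarrow> nat" where
  "conflict_degree m a i = (\<Sum>j\<in>{1..m} - {i}. of_bool (supp (a i) \<inter> supp (a j) \<noteq> {}))"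

definition avg_conflict_degree :: "nat \<Rightarrow> (nat \<Rightarrow> real ^ 'd) \<Rightarrow> real" where
  "avg_conflict_degree m a = 1 / real m * (\<Sum>i=1..m. real (conflict_degree m a i))"

definition max_conflict_degree :: "nat \<Rightarrow> (nat \<Rightarrow> real ^ 'd) \<Rightarrow> nat" where
  "max_conflict_degree m a = Max (conflict_degree m a ` {1..m})"

text \<open>A random mapping is modelled by a seed space \<open>S\<close> and a jointly measurable map
  \<open>Q\<close>: drawing a seed \<open>s\<close> from \<open>S\<close> yields the realisation \<open>Q s\<close>. Finiteness of the moments is
  required explicitly, as the Bochner integral of a non-integrable function is \<open>0\<close>.\<close>

definition unbiased_random_quantizer ::
    "'s measure \<Rightarrow> ('s \<Rightarrow> real ^ 'd \<Rightarrow> real ^ 'd) \<Rightarrow> real \<Rightarrow> bool" where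
  "unbiased_random_quantizer S Q \<alpha> \<longleftrightarrow>
     prob_space S \<and> 0 < \<alpha> \<and>
     (\<lambda>(s, v). Q s v) \<in> borel_measurable (S \<Otimes>\<^sub>M borel) \<and>
     (\<forall>v. (AE s in S. supp (Q s v) \<subseteq> supp v) \<and>
          integrable S (\<lambda>s. Q s v) \<and> (\<integral>s. Q s v \<partial>S) = v \<and>
          integrable S (\<lambda>s. (norm (Q s v))\<^sup>2) \<and>
          (\<integral>s. (norm (Q s v))\<^sup>2 \<partial>S) \<le> \<alpha> * (norm v)\<^sup>2)"

text \<open>Fresh randomness: the seed \<open>\<xi> k i\<close>, used to quantize the \<open>i\<close>-th gradient in iteration \<open>k\<close>,
  has law \<open>S\<close>, and all seeds are mutually independent.\<close>

definition fresh_seeds ::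
    "'w measure \<Rightarrow> 's measure \<Rightarrow> nat \<Rightarrow> (nat \<Rightarrow> nat \<Rightarrow> 'w \<Rightarrow> 's) \<Rightarrow> bool" where
  "fresh_seeds M S m \<xi> \<longleftrightarrow>
     prob_space.indep_vars M (\<lambda>_. S) (\<lambda>(k, i). \<xi> k i) (UNIV \<times> {1..m}) \<and>
     (\<forall>k. \<forall>i\<in>{1..m}. distr M S (\<xi> k i) = S)"

end

theory Submission
  imports Defs
begin

text \<open>
  Write \<open>g\<^sub>i = grad (F i)\<close>, \<open>G = \<Sum> g\<^sub>i\<close>, \<open>V\<^sub>i = Q (\<xi> k i) (g\<^sub>i (x k))\<close> and let \<open>E\<close> be the
  conditional expectation given the past. Expanding the square in one iteration gives
  \<open>\<parallel>x (k+1) - xstar\<parallel>\<^sup>2 = \<parallel>x k - xstar\<parallel>\<^sup>2 - 2 \<gamma> (\<Sum> V\<^sub>i) \<bullet> (x k - xstar) + \<gamma>\<^sup>2 \<parallel>\<Sum> V\<^sub>i\<parallel>\<^sup>2\<close>,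
  and since the quantizer is unbiased, the middle term has mean \<open>- 2 \<gamma> G (x k) \<bullet> (x k - xstar)\<close>.

  The last term is where sparsity enters, improving on the factor \<open>m\<close> of
  \<open>\<parallel>\<Sum> V\<^sub>i\<parallel>\<^sup>2 \<le> m \<Sum> \<parallel>V\<^sub>i\<parallel>\<^sup>2\<close>. Quantization does not enlarge supports, so
  \<open>V\<^sub>i \<bullet> V\<^sub>j = 0\<close> whenever \<open>i\<close> and \<open>j\<close> are not adjacent in the conflict graph.
  Only the adjacent pairs survive, and their contribution is at most \<open>\<sigma> \<Sum> \<parallel>V\<^sub>i\<parallel>\<^sup>2\<close>, by the
  arithmetic-geometric mean inequality for the maximal degree
  (\<open>norm_sum_squared_le_max_conflict\<close>) and by Cauchy-Schwarz for the average degree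
  (\<open>norm_sum_squared_le_avg_conflict\<close>). This inequality holds almost surely, so its expectation involves
  each \<open>V\<^sub>i\<close> separately, and the second-moment bound gives
  \<open>E \<parallel>\<Sum> V\<^sub>i\<parallel>\<^sup>2 \<le> \<sigma> \<alpha> \<Sum> \<parallel>g\<^sub>i (x k)\<parallel>\<^sup>2\<close> (\<open>sparse_quantized_step\<close>).

  Cocoercivity of the gradients and \<open>G xstar = 0\<close> bound \<open>\<Sum> \<parallel>g\<^sub>i z\<parallel>\<^sup>2\<close> by
  \<open>(1 + \<theta>) L G z \<bullet> (z - xstar)\<close> plus \<open>(1 + 1/\<theta>) \<Sum> \<parallel>g\<^sub>i xstar\<parallel>\<^sup>2\<close> (\<open>sum_norm_squared_grad_le\<close>).
  The step size is the one for which \<open>\<gamma> \<sigma> \<alpha> (1 + \<theta>) L = 1\<close>: the quadratic term then eats up exactly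
  half of the descent \<open>2 \<gamma> G z \<bullet> (z - xstar)\<close>, and strong convexity turns the other half into a
  contraction by the factor \<open>1 - \<mu> \<gamma>\<close>, with an additive error
  \<open>\<gamma> / (\<theta> L) \<Sum> \<parallel>g\<^sub>i xstar\<parallel>\<^sup>2\<close> in each step. Summing the geometric series gives the bound.

  Conditional expectations are replaced by Fubini's theorem: \<open>x k\<close> is a function of the seeds of the
  earlier iterations, so the law of \<open>(x k, \<xi> k i)\<close> is the product of the law of \<open>x k\<close> with the seed
  law (\<open>iterate_indep_fresh_seed\<close>), and all moments can be computed by integrating over the seed
  first (\<open>quantized_field_moments\<close>).
\<close>

section \<open>Sums of vectors with overlapping supports\<close>

text \<open>The relation is reflexive even on indices with \<open>a i = 0\<close>, so that every index has exactly one
  neighbour more than its conflict degree counts.\<close>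

definition conflicting :: "(nat \<Rightarrow> real ^ 'd) \<Rightarrow> nat \<Rightarrow> nat \<Rightarrow> bool" where
  "conflicting a i j \<longleftrightarrow> i = j \<or> supp (a i) \<inter> supp (a j) \<noteq> {}"

lemma conflicting_commute: "conflicting a i j \<longleftrightarrow> conflicting a j i"
  by (auto simp: conflicting_def)

lemma supp_diff: "supp (v - w) \<subseteq> supp v \<union> supp w"
  by (auto simp: supp_def)

lemma inner_eq_0_if_disjoint_supp:
  assumes "supp v \<inter> supp w = {}"
  shows "v \<bullet> w = 0"
proof -
  have "v $ i * w $ i = 0" for i
    using assms by (auto simp: supp_def)
  then show ?thesis
    unfolding inner_vec_def by (intro sum.neutral) simp
qed

lemma sum_conflicting:
  assumes "i \<in> {1..m}"
  shows "(\<Sum>j=1..m. of_bool (conflicting a i j)) = 1 + real (conflict_degree m a i)"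
proof -
  have "(\<Sum>j=1..m. of_bool (conflicting a i j)) =
        of_bool (conflicting a i i) + (\<Sum>j\<in>{1..m} - {i}. of_bool (conflicting a i j) :: real)"
    by (rule sum.remove) (use assms in auto)
  also have "(\<Sum>j\<in>{1..m} - {i}. of_bool (conflicting a i j) :: real) = real (conflict_degree m a i)"
    unfolding conflict_degree_def of_nat_sum
    by (intro sum.cong) (auto simp: conflicting_def)
  finally show ?thesis
    by (simp add: conflicting_def)
qed

lemma norm_sum_squared_le_conflicting:
  assumes "\<And>i. i \<in> {1..m} \<Longrightarrow> supp (v i) \<subseteq> supp (a i)"
  shows "(norm (\<Sum>i=1..m. v i))\<^sup>2
    \<le> (\<Sum>i=1..m. \<Sum>j=1..m. of_bool (conflicting a i j) * (norm (v i) * norm (v j)))"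
proof -
  have "(norm (\<Sum>i=1..m. v i))\<^sup>2 = (\<Sum>i=1..m. \<Sum>j=1..m. v i \<bullet> v j)"
    unfolding power2_norm_eq_inner inner_sum_left inner_sum_right by (rule sum.swap)
  also have "\<dots> \<le> (\<Sum>i=1..m. \<Sum>j=1..m. of_bool (conflicting a i j) * (norm (v i) * norm (v j)))"
  proof (intro sum_mono)
    fix i j assume "i \<in> {1..m}" "j \<in> {1..m}"
    then show "v i \<bullet> v j \<le> of_bool (conflicting a i j) * (norm (v i) * norm (v j))"
      using norm_cauchy_schwarz[of "v i" "v j"] assms[of i] assms[of j]
        inner_eq_0_if_disjoint_supp[of "v i" "v j"]
      by (cases "conflicting a i j") (fastforce simp: conflicting_def)+
  qed
  finally show ?thesis .
qed

text \<open>Halving \<open>2 \<parallel>v\<^sub>i\<parallel> \<parallel>v\<^sub>j\<parallel> \<le> \<parallel>v\<^sub>i\<parallel>\<^sup>2 + \<parallel>v\<^sub>j\<parallel>\<^sup>2\<close> and using the symmetry of the conflict relation, each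
  \<open>\<parallel>v\<^sub>i\<parallel>\<^sup>2\<close> is counted once for every neighbour of \<open>i\<close>, itself included.\<close>

lemma norm_sum_squared_le_max_conflict:
  assumes "\<And>i. i \<in> {1..m} \<Longrightarrow> supp (v i) \<subseteq> supp (a i)"
  shows "(norm (\<Sum>i=1..m. v i))\<^sup>2
    \<le> (1 + real (max_conflict_degree m a)) * (\<Sum>i=1..m. (norm (v i))\<^sup>2)"
proof -
  define c :: "nat \<Rightarrow> nat \<Rightarrow> real" where "c i j = of_bool (conflicting a i j)" for i j
  have c_sym: "c i j = c j i" for i j
    by (simp add: c_def conflicting_commute)
  have c_sum: "(\<Sum>j=1..m. c i j) = 1 + real (conflict_degree m a i)" if "i \<in> {1..m}" for i
    using sum_conflicting[OF that] by (simp only: c_def)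
  have "(norm (\<Sum>i=1..m. v i))\<^sup>2 \<le> (\<Sum>i=1..m. \<Sum>j=1..m. c i j * (norm (v i) * norm (v j)))"
    using norm_sum_squared_le_conflicting[OF assms] by (simp add: c_def)
  also have "\<dots> \<le> (\<Sum>i=1..m. \<Sum>j=1..m. c i j * ((norm (v i))\<^sup>2 / 2) + c i j * ((norm (v j))\<^sup>2 / 2))"
  proof (intro sum_mono)
    fix i j
    have "norm (v i) * norm (v j) \<le> (norm (v i))\<^sup>2 / 2 + (norm (v j))\<^sup>2 / 2"
      using sum_squares_bound[of "norm (v i)" "norm (v j)"] by simp
    then show "c i j * (norm (v i) * norm (v j))
        \<le> c i j * ((norm (v i))\<^sup>2 / 2) + c i j * ((norm (v j))\<^sup>2 / 2)"
      unfolding distrib_left[symmetric] by (intro mult_left_mono) (auto simp: c_def)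
  qed
  also have "\<dots> = (\<Sum>i=1..m. \<Sum>j=1..m. c i j * ((norm (v i))\<^sup>2 / 2))
                 + (\<Sum>i=1..m. \<Sum>j=1..m. c i j * ((norm (v j))\<^sup>2 / 2))"
    by (simp add: sum.distrib)
  also have "(\<Sum>i=1..m. \<Sum>j=1..m. c i j * ((norm (v j))\<^sup>2 / 2))
           = (\<Sum>i=1..m. \<Sum>j=1..m. c i j * ((norm (v i))\<^sup>2 / 2))"
    by (subst sum.swap) (simp add: c_sym)
  also have "(\<Sum>i=1..m. \<Sum>j=1..m. c i j * ((norm (v i))\<^sup>2 / 2)) + \<dots>
           = (\<Sum>i=1..m. (1 + real (conflict_degree m a i)) * (norm (v i))\<^sup>2)"
    unfolding sum_distrib_right[symmetric] sum.distrib[symmetric]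
    by (intro sum.cong refl) (simp add: c_sum field_simps del: One_nat_def)
  also have "\<dots> \<le> (\<Sum>i=1..m. (1 + real (max_conflict_degree m a)) * (norm (v i))\<^sup>2)"
    unfolding max_conflict_degree_def by (intro sum_mono mult_right_mono) auto
  finally show ?thesis
    by (simp add: sum_distrib_left)
qed

text \<open>Cauchy-Schwarz over pairs of indices, applied to the adjacency indicator and \<open>\<parallel>v\<^sub>i\<parallel> \<parallel>v\<^sub>j\<parallel>\<close>:
  the indicator has squared norm \<open>m (1 + avg_conflict_degree m a)\<close>, the number of adjacent pairs,
  while the squared norm of the second factor is itself a square.\<close>

lemma norm_sum_squared_le_avg_conflict:
  assumes "\<And>i. i \<in> {1..m} \<Longrightarrow> supp (v i) \<subseteq> supp (a i)"
  shows "(norm (\<Sum>i=1..m. v i))\<^sup>2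
    \<le> sqrt (real m * (1 + avg_conflict_degree m a)) * (\<Sum>i=1..m. (norm (v i))\<^sup>2)"
proof -
  define c :: "nat \<times> nat \<Rightarrow> real" where "c p = of_bool (conflicting a (fst p) (snd p))" for p
  define w where "w p = norm (v (fst p)) * norm (v (snd p))" for p
  let ?I = "{1..m} \<times> {1..m}"
  have "(norm (\<Sum>i=1..m. v i))\<^sup>2 \<le> (\<Sum>p\<in>?I. \<bar>c p\<bar> * \<bar>w p\<bar>)"
  proof -
    have "\<bar>c p\<bar> * \<bar>w p\<bar> = of_bool (conflicting a (fst p) (snd p)) * (norm (v (fst p)) * norm (v (snd p)))" for p
      by (simp add: c_def w_def abs_mult)
    then show ?thesis
      using norm_sum_squared_le_conflicting[of m v a, OF assms]
      by (simp only: sum.cartesian_product case_prod_unfold)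
  qed
  also have "\<dots> \<le> L2_set c ?I * L2_set w ?I"
    by (rule L2_set_mult_ineq)
  also have "L2_set c ?I = sqrt (real m * (1 + avg_conflict_degree m a))"
  proof -
    have "(\<Sum>p\<in>?I. (c p)\<^sup>2) = (\<Sum>i=1..m. \<Sum>j=1..m. of_bool (conflicting a i j))"
      unfolding sum.cartesian_product by (intro sum.cong) (auto simp: c_def)
    also have "\<dots> = (\<Sum>i=1..m. 1 + real (conflict_degree m a i))"
      by (intro sum.cong refl sum_conflicting)
    also have "\<dots> = real m * (1 + avg_conflict_degree m a)"
      by (cases "m = 0") (simp_all add: avg_conflict_degree_def sum.distrib field_simps)
    finally show ?thesis
      by (simp add: L2_set_def)
  qed
  also have "L2_set w ?I = (\<Sum>i=1..m. (norm (v i))\<^sup>2)"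
  proof -
    have "(\<Sum>p\<in>?I. (w p)\<^sup>2) = (\<Sum>i=1..m. (norm (v i))\<^sup>2)\<^sup>2"
      by (simp add: w_def power2_eq_square sum_product sum.cartesian_product case_prod_unfold
          mult.assoc mult.left_commute)
    then show ?thesis
      by (simp add: L2_set_def sum_nonneg)
  qed
  finally show ?thesis .
qed

section \<open>Smooth and strongly convex functions\<close>

text \<open>Compare the lower bound at \<open>x\<close> and the upper bound at \<open>y\<close> in the point
  \<open>y - (grad F y - grad F x) / L\<close>. It minimizes over \<open>z\<close> the gap between the upper parabola at \<open>y\<close>
  and the tangent at \<open>x\<close>, so that the comparison is sharpest there.\<close>

lemma convex_smooth_cocoercive:
  fixes F :: "'a::euclidean_space \<Rightarrow> real"
  assumes "convex_smooth L F" "0 < L"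
  shows "(norm (grad F y - grad F x))\<^sup>2 \<le> 2 * L * (F y - F x - grad F x \<bullet> (y - x))"
proof -
  define d where "d = grad F y - grad F x"
  define z where "z = y - (1 / L) *\<^sub>R d"
  have "F x + grad F x \<bullet> (z - x) \<le> F z"
    using assms(1) by (auto simp: convex_smooth_def)
  also have "F z \<le> F y + grad F y \<bullet> (z - y) + L / 2 * (norm (z - y))\<^sup>2"
    using assms(1) by (auto simp: convex_smooth_def)
  finally have "grad F y \<bullet> d / L - grad F x \<bullet> d / L - L / 2 * (norm d / L)\<^sup>2
      \<le> F y - F x - grad F x \<bullet> (y - x)"
    using assms(2) by (simp add: z_def inner_diff_right)
  moreover have "grad F y \<bullet> d / L - grad F x \<bullet> d / L - L / 2 * (norm d / L)\<^sup>2 = (norm d)\<^sup>2 / (2 * L)"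
  proof -
    have "grad F y \<bullet> d / L - grad F x \<bullet> d / L = (norm d)\<^sup>2 / L"
      by (simp add: d_def power2_norm_eq_inner inner_diff_left diff_divide_distrib)
    then show ?thesis
      using assms(2) by (simp add: field_simps power2_eq_square)
  qed
  ultimately have "(norm d)\<^sup>2 / (2 * L) \<le> F y - F x - grad F x \<bullet> (y - x)"
    by linarith
  then show ?thesis
    using assms(2) by (simp add: d_def pos_divide_le_eq mult.commute)
qed

lemma convex_smooth_cocoercive_inner:
  fixes F :: "'a::euclidean_space \<Rightarrow> real"
  assumes "convex_smooth L F" "0 < L"
  shows "(norm (grad F x - grad F y))\<^sup>2 \<le> L * ((grad F x - grad F y) \<bullet> (x - y))"
  using convex_smooth_cocoercive[OF assms, of x y] convex_smooth_cocoercive[OF assms, of y x]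
  by (simp add: norm_minus_commute[of "grad F x"] inner_diff_left inner_diff_right algebra_simps)

lemma convex_smooth_lipschitz_grad:
  fixes F :: "'a::euclidean_space \<Rightarrow> real"
  assumes "convex_smooth L F" "0 < L"
  shows "norm (grad F x - grad F y) \<le> L * norm (x - y)"
proof -
  have "norm (grad F x - grad F y) * norm (grad F x - grad F y)
      \<le> L * (norm (grad F x - grad F y) * norm (x - y))"
    using convex_smooth_cocoercive_inner[OF assms, of x y] assms(2)
      norm_cauchy_schwarz[of "grad F x - grad F y" "x - y"]
    by (smt (verit) mult_left_mono power2_eq_square)
  then show ?thesis
    using assms(2) by (cases "norm (grad F x - grad F y) = 0") (auto simp: mult_le_cancel_left)
qed

lemma convex_smooth_grad_borel_measurable:
  fixes F :: "'a::euclidean_space \<Rightarrow> real"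
  assumes "convex_smooth L F" "0 < L"
  shows "grad F \<in> borel_measurable borel"
proof (intro borel_measurable_continuous_onI)
  have "L-lipschitz_on UNIV (grad F)"
    using convex_smooth_lipschitz_grad[OF assms] assms(2)
    by (auto simp: lipschitz_on_def dist_norm)
  then show "continuous_on UNIV (grad F)"
    by (rule lipschitz_on_continuous_on)
qed

text \<open>A subgradient bounds \<open>F\<close> from below on the segment from \<open>y\<close> to \<open>x\<close>, strong convexity bounds it
  from above; dividing by \<open>t\<close> and letting \<open>t\<close> tend to \<open>0\<close> improves the subgradient inequality by the
  full quadratic term.\<close>

lemma strongly_convex_subgradient:
  fixes F :: "'a::euclidean_space \<Rightarrow> real"
  assumes sc: "strongly_convex \<mu> F"
    and sub: "\<And>z. F y + g \<bullet> (z - y) \<le> F z"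
  shows "F y + g \<bullet> (x - y) + \<mu> / 2 * (norm (x - y))\<^sup>2 \<le> F x"
proof -
  have bound: "g \<bullet> (x - y) \<le> F x - F y - \<mu> / 2 * (1 - t) * (norm (x - y))\<^sup>2"
    if t: "0 < t" "t < 1" for t
  proof -
    have "F y + g \<bullet> ((t *\<^sub>R x + (1 - t) *\<^sub>R y) - y)
        \<le> t * F x + (1 - t) * F y - \<mu> / 2 * t * (1 - t) * (norm (x - y))\<^sup>2"
      using sub[of "t *\<^sub>R x + (1 - t) *\<^sub>R y"] sc t unfolding strongly_convex_def
      by (meson atLeastAtMost_iff less_imp_le order_trans)
    moreover have "(t *\<^sub>R x + (1 - t) *\<^sub>R y) - y = t *\<^sub>R (x - y)"
      by (simp add: algebra_simps)
    ultimately have "t * (g \<bullet> (x - y)) \<le> t * (F x - F y - \<mu> / 2 * (1 - t) * (norm (x - y))\<^sup>2)"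
      by (simp add: algebra_simps)
    then show ?thesis
      using t by simp
  qed
  have "((\<lambda>t. F x - F y - \<mu> / 2 * (1 - t) * (norm (x - y))\<^sup>2)
      \<longlongrightarrow> F x - F y - \<mu> / 2 * (1 - 0) * (norm (x - y))\<^sup>2) (at_right 0)"
    by (intro tendsto_intros)
  moreover have "\<forall>\<^sub>F t in at_right 0. g \<bullet> (x - y) \<le> F x - F y - \<mu> / 2 * (1 - t) * (norm (x - y))\<^sup>2"
    using bound by (auto simp: eventually_at_right_field intro!: exI[of _ 1])
  ultimately have "g \<bullet> (x - y) \<le> F x - F y - \<mu> / 2 * (1 - 0) * (norm (x - y))\<^sup>2"
    by (intro tendsto_lowerbound) auto
  then show ?thesis
    by simp
qed

section \<open>Randomness that is independent of the past\<close>

lemma abs_inner_le_sum_squares: "\<bar>v \<bullet> w\<bar> \<le> (norm v)\<^sup>2 + (norm w)\<^sup>2"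
  using Cauchy_Schwarz_ineq2[of v w] sum_squares_bound[of "norm v" "norm w"]
    mult_nonneg_nonneg[OF norm_ge_zero norm_ge_zero, of v w]
  by linarith

text \<open>The state at time \<open>k\<close> is a measurable function of the seeds indexed by \<open>{..<k} \<times> {1..m}\<close>, a set
  disjoint from \<open>{(k, i)}\<close>. Independence takes the form of a product law because this is what
  Fubini's theorem is applied to; it is the image of the product law of the two families of seeds.\<close>

lemma iterate_indep_fresh_seed:
  fixes x :: "nat \<Rightarrow> 'w \<Rightarrow> 'v"
  assumes "prob_space M" and fresh: "fresh_seeds M S m \<xi>"
    and x0: "x0 \<in> space N"
    and U: "(\<lambda>(v, h). U v h) \<in> measurable (N \<Otimes>\<^sub>M (\<Pi>\<^sub>M i\<in>{1..m}. S)) N"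
    and init: "\<And>\<omega>. \<omega> \<in> space M \<Longrightarrow> x 0 \<omega> = x0"
    and step: "\<And>k \<omega>. \<omega> \<in> space M \<Longrightarrow> x (Suc k) \<omega> = U (x k \<omega>) (\<lambda>i\<in>{1..m}. \<xi> k i \<omega>)"
  shows "x k \<in> measurable M N"
    and "i \<in> {1..m} \<Longrightarrow>
      distr M (N \<Otimes>\<^sub>M S) (\<lambda>\<omega>. (x k \<omega>, \<xi> k i \<omega>)) = distr M N (x k) \<Otimes>\<^sub>M S"
proof -
  interpret prob_space M by fact
  define A :: "nat \<Rightarrow> (nat \<times> nat) set" where "A k = {..<k} \<times> {1..m}" for k
  have indep: "indep_vars (\<lambda>_. S) (\<lambda>(k, i). \<xi> k i) (UNIV \<times> {1..m})"
    using fresh by (simp add: fresh_seeds_def)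
  have \<xi>_measurable: "\<xi> k i \<in> measurable M S" if "i \<in> {1..m}" for k i
    using indep that by (auto simp: indep_vars_def)
  have ex: "\<exists>Y \<in> measurable (\<Pi>\<^sub>M p\<in>A k. S) N. \<forall>\<omega>\<in>space M.
      x k \<omega> = Y (\<lambda>p\<in>A k. \<xi> (fst p) (snd p) \<omega>)" for k
  proof (induction k)
    case 0
    then show ?case
      using x0 init by (intro bexI[of _ "\<lambda>_. x0"]) auto
  next
    case (Suc k)
    then obtain Y where Y: "Y \<in> measurable (\<Pi>\<^sub>M p\<in>A k. S) N"
      and xY: "\<And>\<omega>. \<omega> \<in> space M \<Longrightarrow> x k \<omega> = Y (\<lambda>p\<in>A k. \<xi> (fst p) (snd p) \<omega>)"
      by blast
    define Y' where "Y' h = U (Y (restrict h (A k))) (\<lambda>i\<in>{1..m}. h (k, i))" for h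
    have sub: "A k \<subseteq> A (Suc k)" and new: "i \<in> {1..m} \<Longrightarrow> (k, i) \<in> A (Suc k)" for i
      by (auto simp: A_def)
    have "(\<lambda>h. (Y (restrict h (A k)), \<lambda>i\<in>{1..m}. h (k, i)))
        \<in> measurable (\<Pi>\<^sub>M p\<in>A (Suc k). S) (N \<Otimes>\<^sub>M (\<Pi>\<^sub>M i\<in>{1..m}. S))"
      using new
      by (intro measurable_Pair measurable_compose[OF measurable_restrict_subset[OF sub] Y]
          measurable_restrict measurable_component_singleton) auto
    from measurable_compose[OF this U] have "Y' \<in> measurable (\<Pi>\<^sub>M p\<in>A (Suc k). S) N"
      by (simp add: Y'_def[abs_def])
    moreover have "x (Suc k) \<omega> = Y' (\<lambda>p\<in>A (Suc k). \<xi> (fst p) (snd p) \<omega>)" if "\<omega> \<in> space M" for \<omega>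
    proof -
      have "restrict (\<lambda>p\<in>A (Suc k). \<xi> (fst p) (snd p) \<omega>) (A k) = (\<lambda>p\<in>A k. \<xi> (fst p) (snd p) \<omega>)"
        using sub by (auto simp: fun_eq_iff)
      moreover have "(\<lambda>i\<in>{1..m}. (\<lambda>p\<in>A (Suc k). \<xi> (fst p) (snd p) \<omega>) (k, i))
          = (\<lambda>i\<in>{1..m}. \<xi> k i \<omega>)"
        using new by (auto simp: fun_eq_iff)
      ultimately show ?thesis
        using that by (simp only: Y'_def step xY)
    qed
    ultimately show ?case
      by blast
  qed
  then obtain Y where Y: "Y \<in> measurable (\<Pi>\<^sub>M p\<in>A k. S) N"
    and xY: "\<And>\<omega>. \<omega> \<in> space M \<Longrightarrow> x k \<omega> = Y (\<lambda>p\<in>A k. \<xi> (fst p) (snd p) \<omega>)"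
    by blast
  have "(\<lambda>\<omega>. Y (\<lambda>p\<in>A k. \<xi> (fst p) (snd p) \<omega>)) \<in> measurable M N"
    by (intro measurable_compose[OF measurable_restrict Y] \<xi>_measurable) (auto simp: A_def)
  then show x_measurable: "x k \<in> measurable M N"
    by (subst measurable_cong[OF xY]) auto
  assume i: "i \<in> {1..m}"
  define past where "past \<omega> = (\<lambda>p\<in>A k. \<xi> (fst p) (snd p) \<omega>)" for \<omega>
  define seed where "seed \<omega> = (\<lambda>p\<in>{(k, i)}. \<xi> (fst p) (snd p) \<omega>)" for \<omega>
  let ?P = "\<Pi>\<^sub>M p\<in>A k. S" and ?S = "\<Pi>\<^sub>M p\<in>{(k, i)}. S"
  have "indep_var ?P past ?S seed"
    using indep_var_restrict[OF indep, of "A k" "{(k, i)}"] i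
    unfolding past_def seed_def case_prod_unfold by (auto simp: A_def)
  then have past: "past \<in> measurable M ?P" and seed: "seed \<in> measurable M ?S"
    and joint: "distr M ?P past \<Otimes>\<^sub>M distr M ?S seed = distr M (?P \<Otimes>\<^sub>M ?S) (\<lambda>\<omega>. (past \<omega>, seed \<omega>))"
    by (auto simp: indep_var_distribution_eq)
  have eval: "(\<lambda>h. h (k, i)) \<in> measurable ?S S"
    by (rule measurable_component_singleton) simp
  have law_x: "distr M N (x k) = distr (distr M ?P past) N Y"
    by (subst distr_distr[OF Y past]) (auto intro!: distr_cong simp: xY past_def)
  have "distr (distr M ?S seed) S (\<lambda>h. h (k, i)) = distr M S (\<xi> k i)"
    by (subst distr_distr[OF eval seed]) (auto intro!: distr_cong simp: seed_def)
  then have law_seed: "distr (distr M ?S seed) S (\<lambda>h. h (k, i)) = S"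
    using fresh i by (simp add: fresh_seeds_def)
  have "prob_space (distr (distr M ?S seed) S (\<lambda>h. h (k, i)))"
    using seed eval by (intro prob_space.prob_space_distr prob_space_distr) simp_all
  then have "distr M N (x k) \<Otimes>\<^sub>M S
      = distr (distr M ?P past \<Otimes>\<^sub>M distr M ?S seed) (N \<Otimes>\<^sub>M S) (\<lambda>(h, h'). (Y h, h' (k, i)))"
    using Y eval unfolding law_x
    by (subst (1) law_seed[symmetric])
      (intro pair_measure_distr prob_space_imp_sigma_finite; simp)
  also have "\<dots> = distr M (N \<Otimes>\<^sub>M S) (\<lambda>\<omega>. (Y (past \<omega>), seed \<omega> (k, i)))"
    unfolding joint using Y eval past seed by (subst distr_distr) (auto simp: comp_def)
  also have "\<dots> = distr M (N \<Otimes>\<^sub>M S) (\<lambda>\<omega>. (x k \<omega>, \<xi> k i \<omega>))"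
    by (intro distr_cong) (auto simp: xY past_def seed_def)
  finally show "distr M (N \<Otimes>\<^sub>M S) (\<lambda>\<omega>. (x k \<omega>, \<xi> k i \<omega>)) = distr M N (x k) \<Otimes>\<^sub>M S" ..
qed

text \<open>The quantizer is only controlled at each fixed argument; by the product law, integrating over
  the seed first extends its properties to the random argument \<open>g X\<close>. The integrability of the
  inner product, on which Fubini's theorem depends, comes from that of the two squares.\<close>

lemma quantized_field_moments:
  fixes Q :: "'s \<Rightarrow> real ^ 'd \<Rightarrow> real ^ 'd" and X :: "'w \<Rightarrow> 'v"
  assumes "prob_space M" and Q: "unbiased_random_quantizer S Q \<alpha>"
    and X: "X \<in> measurable M N" and Z: "Z \<in> measurable M S"
    and joint: "distr M (N \<Otimes>\<^sub>M S) (\<lambda>\<omega>. (X \<omega>, Z \<omega>)) = distr M N X \<Otimes>\<^sub>M S"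
    and [measurable]: "g \<in> borel_measurable N" "h \<in> borel_measurable N"
    and g2: "integrable M (\<lambda>\<omega>. (norm (g (X \<omega>)))\<^sup>2)"
    and h2: "integrable M (\<lambda>\<omega>. (norm (h (X \<omega>)))\<^sup>2)"
  shows "AE \<omega> in M. supp (Q (Z \<omega>) (g (X \<omega>))) \<subseteq> supp (g (X \<omega>))"
    and "integrable M (\<lambda>\<omega>. (norm (Q (Z \<omega>) (g (X \<omega>))))\<^sup>2)"
    and "(\<integral>\<omega>. (norm (Q (Z \<omega>) (g (X \<omega>))))\<^sup>2 \<partial>M) \<le> \<alpha> * (\<integral>\<omega>. (norm (g (X \<omega>)))\<^sup>2 \<partial>M)"
    and "integrable M (\<lambda>\<omega>. Q (Z \<omega>) (g (X \<omega>)) \<bullet> h (X \<omega>))"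
    and "(\<integral>\<omega>. Q (Z \<omega>) (g (X \<omega>)) \<bullet> h (X \<omega>) \<partial>M) = (\<integral>\<omega>. g (X \<omega>) \<bullet> h (X \<omega>) \<partial>M)"
proof -
  interpret prob_space M by fact
  interpret S: prob_space S
    using Q by (simp add: unbiased_random_quantizer_def)
  define D where "D = distr M N X"
  interpret D: prob_space D
    unfolding D_def using X by (rule prob_space_distr)
  interpret DS: pair_prob_space D S ..
  have [measurable_cong]: "sets D = sets N"
    by (simp add: D_def)
  note [measurable] = X Z
  have pair: "(\<lambda>\<omega>. (X \<omega>, Z \<omega>)) \<in> measurable M (N \<Otimes>\<^sub>M S)"
    by measurable
  have DS_eq: "D \<Otimes>\<^sub>M S = distr M (N \<Otimes>\<^sub>M S) (\<lambda>\<omega>. (X \<omega>, Z \<omega>))"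
    by (simp add: D_def joint)
  have Q_measurable: "(\<lambda>p. Q (fst p) (snd p)) \<in> borel_measurable (S \<Otimes>\<^sub>M borel)"
    using Q by (simp add: unbiased_random_quantizer_def case_prod_unfold)
  have Q_supp: "AE s in S. supp (Q s v) \<subseteq> supp v"
    and Q_int: "integrable S (\<lambda>s. Q s v)" and Q_mean: "(\<integral>s. Q s v \<partial>S) = v"
    and Q_int2: "integrable S (\<lambda>s. (norm (Q s v))\<^sup>2)"
    and Q_moment2: "(\<integral>s. (norm (Q s v))\<^sup>2 \<partial>S) \<le> \<alpha> * (norm v)\<^sup>2" for v
    using Q by (auto simp: unbiased_random_quantizer_def)
  have Qg[measurable]: "(\<lambda>p. Q (snd p) (g (fst p))) \<in> borel_measurable (N \<Otimes>\<^sub>M S)"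
    using measurable_compose[of "\<lambda>p. (snd p, g (fst p))" "N \<Otimes>\<^sub>M S", OF _ Q_measurable] by simp
  have [measurable]: "(\<lambda>\<omega>. Q (Z \<omega>) (g (X \<omega>))) \<in> borel_measurable M"
    using measurable_compose[OF pair Qg] by simp

  have supp_sets: "{p \<in> space (N \<Otimes>\<^sub>M S). supp (Q (snd p) (g (fst p))) \<subseteq> supp (g (fst p))} \<in> sets (N \<Otimes>\<^sub>M S)"
  proof -
    have "{p \<in> space (N \<Otimes>\<^sub>M S). supp (Q (snd p) (g (fst p))) \<subseteq> supp (g (fst p))}
        = {p \<in> space (N \<Otimes>\<^sub>M S). \<forall>j. Q (snd p) (g (fst p)) $ j \<noteq> 0 \<longrightarrow> g (fst p) $ j \<noteq> 0}"
      by (auto simp: supp_def)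
    also have "\<dots> \<in> sets (N \<Otimes>\<^sub>M S)"
      by measurable
    finally show ?thesis .
  qed
  have "AE p in D \<Otimes>\<^sub>M S. supp (Q (snd p) (g (fst p))) \<subseteq> supp (g (fst p))"
    by (intro DS.AE_pair_measure) (use supp_sets Q_supp in \<open>auto simp: DS_eq\<close>)
  then show "AE \<omega> in M. supp (Q (Z \<omega>) (g (X \<omega>))) \<subseteq> supp (g (X \<omega>))"
    unfolding DS_eq by (subst (asm) AE_distr_iff[OF pair supp_sets]) simp

  have g2_D: "integrable D (\<lambda>v. (norm (g v))\<^sup>2)"
    using g2 by (simp add: D_def integrable_distr_eq)
  have int2_DS: "integrable (D \<Otimes>\<^sub>M S) (\<lambda>p. (norm (Q (snd p) (g (fst p))))\<^sup>2)"
  proof (rule DS.Fubini_integrable)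
    show "integrable D (\<lambda>v. \<integral>s. norm ((norm (Q (snd (v, s)) (g (fst (v, s)))))\<^sup>2) \<partial>S)"
    proof (rule Bochner_Integration.integrable_bound)
      show "integrable D (\<lambda>v. \<alpha> * (norm (g v))\<^sup>2)"
        using g2_D by simp
      show "AE v in D. norm (\<integral>s. norm ((norm (Q (snd (v, s)) (g (fst (v, s)))))\<^sup>2) \<partial>S)
          \<le> norm (\<alpha> * (norm (g v))\<^sup>2)"
        using Q_moment2 by (auto intro!: AE_I2 order_trans[OF _ abs_ge_self])
    qed measurable
  qed (use Q_int2 in auto)
  then show int2: "integrable M (\<lambda>\<omega>. (norm (Q (Z \<omega>) (g (X \<omega>))))\<^sup>2)"
    by (simp add: DS_eq integrable_distr_eq[OF pair])
  have "(\<integral>\<omega>. (norm (Q (Z \<omega>) (g (X \<omega>))))\<^sup>2 \<partial>M) = (\<integral>p. (norm (Q (snd p) (g (fst p))))\<^sup>2 \<partial>(D \<Otimes>\<^sub>M S))"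
    by (simp add: DS_eq integral_distr[OF pair])
  also have "\<dots> = (\<integral>v. (\<integral>s. (norm (Q s (g v)))\<^sup>2 \<partial>S) \<partial>D)"
    using DS.integral_fst'[OF int2_DS] by simp
  also have "\<dots> \<le> (\<integral>v. \<alpha> * (norm (g v))\<^sup>2 \<partial>D)"
    using DS.integrable_fst'[OF int2_DS] g2_D Q_moment2 by (intro integral_mono) auto
  also have "\<dots> = \<alpha> * (\<integral>\<omega>. (norm (g (X \<omega>)))\<^sup>2 \<partial>M)"
    by (simp add: D_def integral_distr)
  finally show "(\<integral>\<omega>. (norm (Q (Z \<omega>) (g (X \<omega>))))\<^sup>2 \<partial>M) \<le> \<alpha> * (\<integral>\<omega>. (norm (g (X \<omega>)))\<^sup>2 \<partial>M)" .

  show inti: "integrable M (\<lambda>\<omega>. Q (Z \<omega>) (g (X \<omega>)) \<bullet> h (X \<omega>))"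
  proof (rule Bochner_Integration.integrable_bound)
    show "integrable M (\<lambda>\<omega>. (norm (Q (Z \<omega>) (g (X \<omega>))))\<^sup>2 + (norm (h (X \<omega>)))\<^sup>2)"
      using int2 h2 by simp
    show "AE \<omega> in M. norm (Q (Z \<omega>) (g (X \<omega>)) \<bullet> h (X \<omega>))
        \<le> norm ((norm (Q (Z \<omega>) (g (X \<omega>))))\<^sup>2 + (norm (h (X \<omega>)))\<^sup>2)"
      by (intro AE_I2) (simp add: abs_inner_le_sum_squares)
  qed measurable
  then have inti_DS: "integrable (D \<Otimes>\<^sub>M S) (\<lambda>p. Q (snd p) (g (fst p)) \<bullet> h (fst p))"
    by (simp add: DS_eq integrable_distr_eq[OF pair])
  have "(\<integral>\<omega>. Q (Z \<omega>) (g (X \<omega>)) \<bullet> h (X \<omega>) \<partial>M) = (\<integral>p. Q (snd p) (g (fst p)) \<bullet> h (fst p) \<partial>(D \<Otimes>\<^sub>M S))"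
    by (simp add: DS_eq integral_distr[OF pair])
  also have "\<dots> = (\<integral>v. (\<integral>s. Q s (g v) \<bullet> h v \<partial>S) \<partial>D)"
    using DS.integral_fst'[OF inti_DS] by simp
  also have "\<dots> = (\<integral>v. g v \<bullet> h v \<partial>D)"
    by (simp add: Q_int Q_mean)
  also have "\<dots> = (\<integral>\<omega>. g (X \<omega>) \<bullet> h (X \<omega>) \<partial>M)"
    by (simp add: D_def integral_distr)
  finally show "(\<integral>\<omega>. Q (Z \<omega>) (g (X \<omega>)) \<bullet> h (X \<omega>) \<partial>M) = (\<integral>\<omega>. g (X \<omega>) \<bullet> h (X \<omega>) \<partial>M)" .
qed

text \<open>Jensen's inequality at a unit vector, in the form \<open>0 \<le> \<parallel>Q s v - v\<parallel>\<^sup>2\<close>: the second moment is at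
  least the square of the mean.\<close>

lemma unbiased_random_quantizer_parameter_ge_1:
  fixes Q :: "'s \<Rightarrow> real ^ 'd \<Rightarrow> real ^ 'd"
  assumes "unbiased_random_quantizer S Q \<alpha>"
  shows "1 \<le> \<alpha>"
proof -
  interpret S: prob_space S
    using assms by (simp add: unbiased_random_quantizer_def)
  define v :: "real ^ 'd" where "v = axis undefined 1"
  have v: "v \<bullet> v = 1"
    by (simp add: v_def inner_axis)
  have int: "integrable S (\<lambda>s. Q s v)" and mean: "(\<integral>s. Q s v \<partial>S) = v"
    and int2: "integrable S (\<lambda>s. (norm (Q s v))\<^sup>2)"
    and moment2: "(\<integral>s. (norm (Q s v))\<^sup>2 \<partial>S) \<le> \<alpha> * (norm v)\<^sup>2"
    using assms by (auto simp: unbiased_random_quantizer_def)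
  have "1 = (\<integral>s. 2 * (Q s v \<bullet> v) - v \<bullet> v \<partial>S)"
    using int by (simp add: mean v S.prob_space)
  also have "\<dots> \<le> (\<integral>s. (norm (Q s v))\<^sup>2 \<partial>S)"
  proof (intro integral_mono)
    show "2 * (Q s v \<bullet> v) - v \<bullet> v \<le> (norm (Q s v))\<^sup>2" for s
      using inner_ge_zero[of "Q s v - v"]
      by (simp add: power2_norm_eq_inner inner_diff_left inner_diff_right inner_commute)
  qed (use int int2 in auto)
  also have "\<dots> \<le> \<alpha>"
    using moment2 v by (simp add: power2_norm_eq_inner)
  finally show ?thesis .
qed

section \<open>Contraction in expectation\<close>

lemma integral_linear_combination_sums:
  fixes A :: "'w \<Rightarrow> real" and p q :: "'i \<Rightarrow> 'w \<Rightarrow> real"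
  assumes A: "integrable M A" and p: "\<And>i. i \<in> I \<Longrightarrow> integrable M (p i)"
    and q: "\<And>i. i \<in> I \<Longrightarrow> integrable M (q i)"
  shows "integrable M (\<lambda>\<omega>. A \<omega> - s * (\<Sum>i\<in>I. p i \<omega>) + t * (\<Sum>i\<in>I. q i \<omega>))"
    and "(\<integral>\<omega>. A \<omega> - s * (\<Sum>i\<in>I. p i \<omega>) + t * (\<Sum>i\<in>I. q i \<omega>) \<partial>M)
      = (\<integral>\<omega>. A \<omega> \<partial>M) - s * (\<Sum>i\<in>I. \<integral>\<omega>. p i \<omega> \<partial>M) + t * (\<Sum>i\<in>I. \<integral>\<omega>. q i \<omega> \<partial>M)"
proof -
  have sums: "integrable M (\<lambda>\<omega>. \<Sum>i\<in>I. p i \<omega>)" "integrable M (\<lambda>\<omega>. \<Sum>i\<in>I. q i \<omega>)"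
    using p q by (auto intro!: Bochner_Integration.integrable_sum)
  have "(\<integral>\<omega>. (\<Sum>i\<in>I. p i \<omega>) \<partial>M) = (\<Sum>i\<in>I. \<integral>\<omega>. p i \<omega> \<partial>M)"
    "(\<integral>\<omega>. (\<Sum>i\<in>I. q i \<omega>) \<partial>M) = (\<Sum>i\<in>I. \<integral>\<omega>. q i \<omega> \<partial>M)"
    using p q by (auto intro!: Bochner_Integration.integral_sum)
  then show "(\<integral>\<omega>. A \<omega> - s * (\<Sum>i\<in>I. p i \<omega>) + t * (\<Sum>i\<in>I. q i \<omega>) \<partial>M)
      = (\<integral>\<omega>. A \<omega> \<partial>M) - s * (\<Sum>i\<in>I. \<integral>\<omega>. p i \<omega> \<partial>M) + t * (\<Sum>i\<in>I. \<integral>\<omega>. q i \<omega> \<partial>M)"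
    using A sums by simp
  show "integrable M (\<lambda>\<omega>. A \<omega> - s * (\<Sum>i\<in>I. p i \<omega>) + t * (\<Sum>i\<in>I. q i \<omega>))"
    using A sums by simp
qed

text \<open>The expansion of the square described at the start. The conflict graph enters through the
  constant \<open>\<sigma>\<close> with which sums of vectors of the given supports are bounded.\<close>

lemma sparse_quantized_step:
  fixes Q :: "'s \<Rightarrow> real ^ 'd \<Rightarrow> real ^ 'd" and X X' :: "'w \<Rightarrow> real ^ 'd"
    and Z :: "nat \<Rightarrow> 'w \<Rightarrow> 's"
  assumes "prob_space M" and Q: "unbiased_random_quantizer S Q \<alpha>"
    and X[measurable]: "X \<in> borel_measurable M" and X'[measurable]: "X' \<in> borel_measurable M"
    and Z: "\<And>i. i \<in> {1..m} \<Longrightarrow> Z i \<in> measurable M S"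
    and joint: "\<And>i. i \<in> {1..m} \<Longrightarrow>
      distr M (borel \<Otimes>\<^sub>M S) (\<lambda>\<omega>. (X \<omega>, Z i \<omega>)) = distr M borel X \<Otimes>\<^sub>M S"
    and g[measurable]: "\<And>i. i \<in> {1..m} \<Longrightarrow> g i \<in> borel_measurable borel"
    and supp_g: "\<And>i z. i \<in> {1..m} \<Longrightarrow> supp (g i z) \<subseteq> supp (a i)"
    and spread: "\<And>v. (\<And>i. i \<in> {1..m} \<Longrightarrow> supp (v i) \<subseteq> supp (a i)) \<Longrightarrow>
      (norm (\<Sum>i=1..m. v i))\<^sup>2 \<le> \<sigma> * (\<Sum>i=1..m. (norm (v i))\<^sup>2)"
    and "0 \<le> \<sigma>"
    and g2: "\<And>i. i \<in> {1..m} \<Longrightarrow> integrable M (\<lambda>\<omega>. (norm (g i (X \<omega>)))\<^sup>2)"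
    and X2: "integrable M (\<lambda>\<omega>. (norm (X \<omega> - c))\<^sup>2)"
    and step: "\<And>\<omega>. \<omega> \<in> space M \<Longrightarrow>
      X' \<omega> = X \<omega> - \<gamma> *\<^sub>R (\<Sum>i=1..m. Q (Z i \<omega>) (g i (X \<omega>)))"
  defines "B \<equiv> \<lambda>z. (norm (z - c))\<^sup>2 - 2 * \<gamma> * (\<Sum>i=1..m. g i z \<bullet> (z - c))
      + \<gamma>\<^sup>2 * \<sigma> * \<alpha> * (\<Sum>i=1..m. (norm (g i z))\<^sup>2)"
  shows "integrable M (\<lambda>\<omega>. (norm (X' \<omega> - c))\<^sup>2)"
    and "integrable M (\<lambda>\<omega>. B (X \<omega>))"
    and "(\<integral>\<omega>. (norm (X' \<omega> - c))\<^sup>2 \<partial>M) \<le> (\<integral>\<omega>. B (X \<omega>) \<partial>M)"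
proof -
  interpret prob_space M by fact
  define V where "V i \<omega> = Q (Z i \<omega>) (g i (X \<omega>))" for i \<omega>
  have h: "(\<lambda>z. z - c) \<in> borel_measurable borel"
    by measurable
  have V_supp: "AE \<omega> in M. supp (V i \<omega>) \<subseteq> supp (g i (X \<omega>))"
    and V2: "integrable M (\<lambda>\<omega>. (norm (V i \<omega>))\<^sup>2)"
    and V_moment2: "(\<integral>\<omega>. (norm (V i \<omega>))\<^sup>2 \<partial>M) \<le> \<alpha> * (\<integral>\<omega>. (norm (g i (X \<omega>)))\<^sup>2 \<partial>M)"
    and V_inner: "integrable M (\<lambda>\<omega>. V i \<omega> \<bullet> (X \<omega> - c))"
    and V_mean: "(\<integral>\<omega>. V i \<omega> \<bullet> (X \<omega> - c) \<partial>M) = (\<integral>\<omega>. g i (X \<omega>) \<bullet> (X \<omega> - c) \<partial>M)"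
    if i: "i \<in> {1..m}" for i
    unfolding V_def
    by (fact quantized_field_moments[OF \<open>prob_space M\<close> Q X Z[OF i] joint[OF i] g[OF i] h g2[OF i] X2])+
  have gX_inner: "integrable M (\<lambda>\<omega>. g i (X \<omega>) \<bullet> (X \<omega> - c))" if [measurable, simp]: "i \<in> {1..m}" for i
  proof (rule Bochner_Integration.integrable_bound)
    show "integrable M (\<lambda>\<omega>. (norm (g i (X \<omega>)))\<^sup>2 + (norm (X \<omega> - c))\<^sup>2)"
      using g2 X2 that by simp
    show "AE \<omega> in M. norm (g i (X \<omega>) \<bullet> (X \<omega> - c)) \<le> norm ((norm (g i (X \<omega>)))\<^sup>2 + (norm (X \<omega> - c))\<^sup>2)"
      by (intro AE_I2) (simp add: abs_inner_le_sum_squares)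
    show "(\<lambda>\<omega>. g i (X \<omega>) \<bullet> (X \<omega> - c)) \<in> borel_measurable M"
      using measurable_compose[OF X g[OF that]] by measurable
  qed
  show B_int: "integrable M (\<lambda>\<omega>. B (X \<omega>))"
    unfolding B_def using X2 gX_inner g2 by (rule integral_linear_combination_sums(1))

  define W where "W \<omega> = (norm (X \<omega> - c))\<^sup>2 - 2 * \<gamma> * (\<Sum>i=1..m. V i \<omega> \<bullet> (X \<omega> - c))
      + \<gamma>\<^sup>2 * \<sigma> * (\<Sum>i=1..m. (norm (V i \<omega>))\<^sup>2)" for \<omega>
  have W_int: "integrable M W"
    unfolding W_def using X2 V_inner V2 by (rule integral_linear_combination_sums(1))
  have "AE \<omega> in M. \<forall>i\<in>{1..m}. supp (V i \<omega>) \<subseteq> supp (a i)"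
  proof (intro AE_finite_allI)
    fix i assume i: "i \<in> {1..m}"
    show "AE \<omega> in M. supp (V i \<omega>) \<subseteq> supp (a i)"
      using V_supp[OF i] supp_g[OF i] by (auto elim!: eventually_mono)
  qed simp
  then have le_W: "AE \<omega> in M. (norm (X' \<omega> - c))\<^sup>2 \<le> W \<omega>"
  proof (rule AE_mp, intro AE_I2 impI)
    fix \<omega> assume \<omega>: "\<omega> \<in> space M" and supp_V: "\<forall>i\<in>{1..m}. supp (V i \<omega>) \<subseteq> supp (a i)"
    have "(norm (X' \<omega> - c))\<^sup>2 = (norm ((X \<omega> - c) - \<gamma> *\<^sub>R (\<Sum>i=1..m. V i \<omega>)))\<^sup>2"
      by (simp add: step[OF \<omega>] V_def algebra_simps)
    also have "\<dots> = (norm (X \<omega> - c))\<^sup>2 - 2 * \<gamma> * ((\<Sum>i=1..m. V i \<omega>) \<bullet> (X \<omega> - c))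
        + \<gamma>\<^sup>2 * (norm (\<Sum>i=1..m. V i \<omega>))\<^sup>2"
      unfolding power2_norm_eq_inner
      by (simp add: inner_diff_left inner_diff_right inner_commute power2_eq_square algebra_simps)
    also have "\<dots> \<le> W \<omega>"
      using spread[of "\<lambda>i. V i \<omega>"] supp_V
      by (simp add: W_def inner_sum_left mult.assoc mult_left_mono)
    finally show "(norm (X' \<omega> - c))\<^sup>2 \<le> W \<omega>" .
  qed
  show X'2: "integrable M (\<lambda>\<omega>. (norm (X' \<omega> - c))\<^sup>2)"
    using le_W by (intro Bochner_Integration.integrable_bound[OF W_int]) (auto elim!: eventually_mono)
  have "(\<integral>\<omega>. (norm (X' \<omega> - c))\<^sup>2 \<partial>M) \<le> (\<integral>\<omega>. W \<omega> \<partial>M)"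
    using X'2 W_int le_W by (rule integral_mono_AE)
  also have "\<dots> = (\<integral>\<omega>. (norm (X \<omega> - c))\<^sup>2 \<partial>M) - 2 * \<gamma> * (\<Sum>i=1..m. \<integral>\<omega>. V i \<omega> \<bullet> (X \<omega> - c) \<partial>M)
      + \<gamma>\<^sup>2 * \<sigma> * (\<Sum>i=1..m. \<integral>\<omega>. (norm (V i \<omega>))\<^sup>2 \<partial>M)"
    unfolding W_def using X2 V_inner V2 by (rule integral_linear_combination_sums(2))
  also have "\<dots> \<le> (\<integral>\<omega>. (norm (X \<omega> - c))\<^sup>2 \<partial>M) - 2 * \<gamma> * (\<Sum>i=1..m. \<integral>\<omega>. g i (X \<omega>) \<bullet> (X \<omega> - c) \<partial>M)
      + \<gamma>\<^sup>2 * \<sigma> * (\<Sum>i=1..m. \<alpha> * (\<integral>\<omega>. (norm (g i (X \<omega>)))\<^sup>2 \<partial>M))"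
  proof -
    have "(\<Sum>i=1..m. \<integral>\<omega>. V i \<omega> \<bullet> (X \<omega> - c) \<partial>M) = (\<Sum>i=1..m. \<integral>\<omega>. g i (X \<omega>) \<bullet> (X \<omega> - c) \<partial>M)"
      by (rule sum.cong[OF refl V_mean])
    moreover have "\<gamma>\<^sup>2 * \<sigma> * (\<Sum>i=1..m. \<integral>\<omega>. (norm (V i \<omega>))\<^sup>2 \<partial>M)
        \<le> \<gamma>\<^sup>2 * \<sigma> * (\<Sum>i=1..m. \<alpha> * (\<integral>\<omega>. (norm (g i (X \<omega>)))\<^sup>2 \<partial>M))"
      using \<open>0 \<le> \<sigma>\<close> by (intro mult_left_mono sum_mono V_moment2) auto
    ultimately show ?thesis
      by (simp only: add_left_mono)
  qed
  also have "\<dots> = (\<integral>\<omega>. B (X \<omega>) \<partial>M)"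
    unfolding B_def
    by (subst integral_linear_combination_sums(2)[OF X2 gX_inner g2])
      (simp_all add: mult.assoc flip: sum_distrib_left)
  finally show "(\<integral>\<omega>. (norm (X' \<omega> - c))\<^sup>2 \<partial>M) \<le> (\<integral>\<omega>. B (X \<omega>) \<partial>M)" .
qed

text \<open>Gradients need not vanish individually at the stationary point \<open>c\<close>, so \<open>\<parallel>g\<^sub>i z\<parallel>\<^sup>2\<close> is split by
  Young's inequality, with weight \<open>\<theta>\<close>, into a deviation from \<open>g\<^sub>i c\<close>, controlled by cocoercivity, and
  \<open>\<parallel>g\<^sub>i c\<parallel>\<^sup>2\<close>. In the sum over \<open>i\<close> the inner products with \<open>g\<^sub>i c\<close> cancel.\<close>

lemma sum_norm_squared_grad_le:
  fixes F :: "'i \<Rightarrow> 'a::euclidean_space \<Rightarrow> real"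
  assumes smooth: "\<And>i. i \<in> I \<Longrightarrow> convex_smooth L (F i)" and "0 < L" and "0 < \<theta>"
    and stationary: "(\<Sum>i\<in>I. grad (F i) c) = 0"
  shows "(\<Sum>i\<in>I. (norm (grad (F i) z))\<^sup>2)
    \<le> (1 + \<theta>) * L * (\<Sum>i\<in>I. grad (F i) z \<bullet> (z - c)) + (1 + 1 / \<theta>) * (\<Sum>i\<in>I. (norm (grad (F i) c))\<^sup>2)"
proof -
  have young: "(norm u)\<^sup>2 \<le> (1 + \<theta>) * (norm (u - w))\<^sup>2 + (1 + 1 / \<theta>) * (norm w)\<^sup>2" for u w :: 'a
  proof -
    define d where "d = u - w"
    have "0 \<le> (norm (\<theta> *\<^sub>R d - w))\<^sup>2"
      by simp
    also have "\<dots> = \<theta> * (\<theta> * (d \<bullet> d) + (w \<bullet> w) / \<theta> - 2 * (d \<bullet> w))"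
      using \<open>0 < \<theta>\<close> unfolding power2_norm_eq_inner
      by (simp add: inner_diff_left inner_diff_right inner_commute field_simps)
    finally have "0 \<le> \<theta> * (d \<bullet> d) + (w \<bullet> w) / \<theta> - 2 * (d \<bullet> w)"
      using \<open>0 < \<theta>\<close> by (simp add: zero_le_mult_iff)
    moreover have "(norm u)\<^sup>2 = d \<bullet> d + 2 * (d \<bullet> w) + w \<bullet> w"
      by (simp add: d_def power2_norm_eq_inner inner_diff_left inner_diff_right inner_commute)
    ultimately show ?thesis
      unfolding d_def[symmetric] by (simp add: power2_norm_eq_inner algebra_simps)
  qed
  have "(norm (grad (F i) z))\<^sup>2 \<le> (1 + \<theta>) * (L * ((grad (F i) z - grad (F i) c) \<bullet> (z - c)))
      + (1 + 1 / \<theta>) * (norm (grad (F i) c))\<^sup>2" if "i \<in> I" for i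
    using young[of "grad (F i) z" "grad (F i) c"] \<open>0 < \<theta>\<close>
      mult_left_mono[OF convex_smooth_cocoercive_inner[OF smooth[OF that] \<open>0 < L\<close>, of z c], of "1 + \<theta>"]
    by linarith
  then have "(\<Sum>i\<in>I. (norm (grad (F i) z))\<^sup>2)
      \<le> (\<Sum>i\<in>I. (1 + \<theta>) * (L * ((grad (F i) z - grad (F i) c) \<bullet> (z - c)))
          + (1 + 1 / \<theta>) * (norm (grad (F i) c))\<^sup>2)"
    by (rule sum_mono)
  also have "\<dots> = (1 + \<theta>) * (L * (\<Sum>i\<in>I. (grad (F i) z - grad (F i) c) \<bullet> (z - c)))
      + (1 + 1 / \<theta>) * (\<Sum>i\<in>I. (norm (grad (F i) c))\<^sup>2)"
    by (simp add: sum.distrib sum_distrib_left)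
  also have "(\<Sum>i\<in>I. (grad (F i) z - grad (F i) c) \<bullet> (z - c)) = (\<Sum>i\<in>I. grad (F i) z \<bullet> (z - c))"
    using stationary by (simp add: inner_diff_left sum_subtractf flip: inner_sum_left)
  finally show ?thesis
    by (simp add: mult.assoc)
qed

theorem theorem5p2:
  fixes m :: nat
    and F :: "nat \<Rightarrow> real ^ 'd \<Rightarrow> real"
    and f :: "real ^ 'd \<Rightarrow> real"
    and l :: "real \<Rightarrow> real \<Rightarrow> real"
    and a :: "nat \<Rightarrow> real ^ 'd"
    and b :: "nat \<Rightarrow> real"
    and L \<mu> \<alpha> \<theta> \<sigma> \<gamma> :: real
    and xstar x0 :: "real ^ 'd"
    and S :: "'s measure"
    and Q :: "'s \<Rightarrow> real ^ 'd \<Rightarrow> real ^ 'd"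
    and M :: "'w measure"
    and \<xi> :: "nat \<Rightarrow> nat \<Rightarrow> 'w \<Rightarrow> 's"
    and x :: "nat \<Rightarrow> 'w \<Rightarrow> real ^ 'd"
  assumes f_sum: "f = (\<lambda>z. \<Sum>i=1..m. F i z)"
    and smooth: "\<And>i. i \<in> {1..m} \<Longrightarrow> convex_smooth L (F i)"
    and mu_pos: "0 < \<mu>"
    and strong: "strongly_convex \<mu> f"
    and loss: "\<And>i z. i \<in> {1..m} \<Longrightarrow> F i z = l (a i \<bullet> z) (b i)"
    and supp_grad: "\<And>i z. i \<in> {1..m} \<Longrightarrow> supp (grad (F i) z) = supp (a i)"
    and minimizer: "\<And>z. f xstar \<le> f z"
    and sigma: "\<sigma> = min (sqrt (real m * (1 + avg_conflict_degree m a)))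
                         (1 + real (max_conflict_degree m a))"
    and quantizer: "unbiased_random_quantizer S Q \<alpha>"
    and theta_pos: "0 < \<theta>"
    and gamma: "\<gamma> = 1 / (L * \<alpha> * (1 + \<theta>) * \<sigma>)"
    and prob: "prob_space M"
    and fresh: "fresh_seeds M S m \<xi>"
    and init: "\<And>\<omega>. \<omega> \<in> space M \<Longrightarrow> x 0 \<omega> = x0"
    and step: "\<And>k \<omega>. \<omega> \<in> space M \<Longrightarrow>
        x (Suc k) \<omega> = x k \<omega> - \<gamma> *\<^sub>R (\<Sum>i=1..m. Q (\<xi> k i \<omega>) (grad (F i) (x k \<omega>)))"
  shows "\<forall>k. integrable M (\<lambda>\<omega>. (norm (x k \<omega> - xstar))\<^sup>2) \<and>
      (\<integral>\<omega>. (norm (x k \<omega> - xstar))\<^sup>2 \<partial>M)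
        \<le> (1 - \<mu> * \<gamma>) ^ k * (norm (x0 - xstar))\<^sup>2
          + 1 / (\<mu> * \<theta> * L) * (\<Sum>i=1..m. (norm (grad (F i) xstar))\<^sup>2)"
proof -
  interpret prob_space M by (rule prob)
  define g where "g i = grad (F i)" for i
  define G where "G z = (\<Sum>i=1..m. g i z)" for z
  define C where "C = (\<Sum>i=1..m. (norm (g i xstar))\<^sup>2)"

  have f_lower: "f y + G y \<bullet> (z - y) \<le> f z" for y z
    unfolding f_sum G_def g_def inner_sum_left sum.distrib[symmetric]
    using smooth by (intro sum_mono) (auto simp: convex_smooth_def)
  have f_upper: "f z \<le> f y + G y \<bullet> (z - y) + real m * L / 2 * (norm (z - y))\<^sup>2" for y z
  proof -
    have "f z \<le> (\<Sum>i=1..m. F i y + g i y \<bullet> (z - y) + L / 2 * (norm (z - y))\<^sup>2)"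
      unfolding f_sum g_def using smooth by (intro sum_mono) (auto simp: convex_smooth_def)
    then show ?thesis
      by (simp add: f_sum G_def inner_sum_left sum.distrib)
  qed
  have f_strong: "f y + G y \<bullet> (z - y) + \<mu> / 2 * (norm (z - y))\<^sup>2 \<le> f z" for y z
    using strong f_lower by (rule strongly_convex_subgradient)

  \<comment> \<open>A strongly convex function cannot be affine: moving by a unit vector shows that \<open>m\<close> and \<open>L\<close> are
    both positive.\<close>
  define e :: "real ^ 'd" where "e = axis undefined 1"
  have e: "norm e = 1"
    by (simp add: e_def)
  have "\<mu> \<le> real m * L"
    using f_strong[of xstar "xstar + e"] f_upper[of "xstar + e" xstar] e by simp
  then have mL: "0 < real m * L"
    using mu_pos by linarith
  then have L_pos: "0 < L" and m_pos: "0 < m"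
    by (auto simp: zero_less_mult_iff)

  have stationary: "G xstar = 0"
  proof -
    define K where "K = real m * L"
    have K: "0 < K"
      using mL by (simp add: K_def)
    \<comment> \<open>A gradient step of length \<open>1 / K\<close> would decrease \<open>f\<close> if the gradient were nonzero.\<close>
    define z where "z = xstar - (1 / K) *\<^sub>R G xstar"
    have "f xstar \<le> f z"
      by (rule minimizer)
    also have "\<dots> \<le> f xstar + G xstar \<bullet> (z - xstar) + K / 2 * (norm (z - xstar))\<^sup>2"
      using f_upper by (simp add: K_def)
    also have "\<dots> = f xstar - (norm (G xstar))\<^sup>2 / (2 * K)"
      using K by (simp add: z_def power_divide power2_norm_eq_inner[symmetric] field_simps power2_eq_square)
    finally show ?thesis
      using K by (simp add: divide_le_0_iff)
  qed
  have monotone: "\<mu> * (norm (z - xstar))\<^sup>2 \<le> G z \<bullet> (z - xstar)" for z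
    using f_strong[of xstar z] f_strong[of z xstar] stationary
    by (simp add: norm_minus_commute[of xstar] inner_diff_right)

  have sigma_pos: "0 < \<sigma>"
  proof -
    have "0 \<le> avg_conflict_degree m a"
      by (simp add: avg_conflict_degree_def sum_nonneg)
    then show ?thesis
      using m_pos by (simp add: sigma)
  qed
  have spread: "(norm (\<Sum>i=1..m. v i))\<^sup>2 \<le> \<sigma> * (\<Sum>i=1..m. (norm (v i))\<^sup>2)"
    if "\<And>i. i \<in> {1..m} \<Longrightarrow> supp (v i) \<subseteq> supp (a i)" for v
  proof -
    have "(norm (\<Sum>i=1..m. v i))\<^sup>2
        \<le> sqrt (real m * (1 + avg_conflict_degree m a)) * (\<Sum>i=1..m. (norm (v i))\<^sup>2)"
      using that by (rule norm_sum_squared_le_avg_conflict)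
    moreover have "(norm (\<Sum>i=1..m. v i))\<^sup>2
        \<le> (1 + real (max_conflict_degree m a)) * (\<Sum>i=1..m. (norm (v i))\<^sup>2)"
      using that by (rule norm_sum_squared_le_max_conflict)
    ultimately show ?thesis
      by (simp add: sigma min_def)
  qed
  have alpha_ge_1: "1 \<le> \<alpha>"
    using quantizer by (rule unbiased_random_quantizer_parameter_ge_1)
  have gamma_pos: "0 < \<gamma>"
    using L_pos alpha_ge_1 theta_pos sigma_pos by (simp add: gamma)
  have gamma_eq: "\<gamma> * \<sigma> * \<alpha> * ((1 + \<theta>) * L) = 1"
    using L_pos alpha_ge_1 theta_pos sigma_pos by (simp add: gamma)

  \<comment> \<open>The conflict bound, applied to differences of gradients, bounds the gradient of \<open>f\<close> at unit
    distance from \<open>xstar\<close> by \<open>L \<sigma>\<close>, while strong convexity bounds it from below by \<open>\<mu>\<close>. Together with \<open>1 \<le> \<alpha>\<close> this makes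
    the contraction factor nonnegative, without which the recursion could not be iterated.\<close>
  have "\<mu> \<le> L * \<sigma>"
  proof -
    define z where "z = xstar + e"
    have z: "z - xstar = e"
      by (simp add: z_def)
    have "supp (g i z - g i xstar) \<subseteq> supp (a i)" if "i \<in> {1..m}" for i
      using supp_diff[of "g i z" "g i xstar"] by (simp add: g_def supp_grad[OF that])
    then have "(norm (\<Sum>i=1..m. g i z - g i xstar))\<^sup>2 \<le> \<sigma> * (\<Sum>i=1..m. (norm (g i z - g i xstar))\<^sup>2)"
      by (rule spread)
    also have "\<dots> \<le> \<sigma> * (\<Sum>i=1..m. L * ((g i z - g i xstar) \<bullet> (z - xstar)))"
      unfolding g_def using sigma_pos L_pos smooth
      by (intro mult_left_mono sum_mono convex_smooth_cocoercive_inner) auto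
    also have "(\<Sum>i=1..m. g i z - g i xstar) = G z"
      using stationary by (simp add: G_def sum_subtractf)
    also have "(\<Sum>i=1..m. L * ((g i z - g i xstar) \<bullet> (z - xstar))) = L * (G z \<bullet> e)"
      using stationary
      by (simp add: G_def z sum_subtractf inner_diff_left flip: sum_distrib_left inner_sum_left)
    finally have "(norm (G z))\<^sup>2 \<le> (L * \<sigma>) * (G z \<bullet> e)"
      by (simp add: mult_ac)
    moreover have "\<mu> \<le> G z \<bullet> e"
      using monotone[of z] e by (simp add: z)
    moreover have "G z \<bullet> e \<le> norm (G z)"
      using norm_cauchy_schwarz[of "G z" e] e by simp
    ultimately show ?thesis
      using mu_pos L_pos sigma_pos
      by (smt (verit, best) mult_le_cancel_right mult_left_mono mult_pos_pos power2_eq_square)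
  qed
  also have "\<dots> \<le> L * \<sigma> * (\<alpha> * (1 + \<theta>))"
    using L_pos sigma_pos alpha_ge_1 theta_pos mult_mono[of 1 \<alpha> 1 "1 + \<theta>"]
      mult_left_mono[of 1 "\<alpha> * (1 + \<theta>)" "L * \<sigma>"]
    by simp
  finally have "\<gamma> * \<mu> \<le> \<gamma> * (L * \<sigma> * (\<alpha> * (1 + \<theta>)))"
    using gamma_pos by simp
  also have "\<dots> = 1"
    using gamma_eq by (simp only: mult_ac)
  finally have contraction: "0 \<le> 1 - \<mu> * \<gamma>"
    by (simp add: mult.commute)

  have g_measurable: "g i \<in> borel_measurable borel" if "i \<in> {1..m}" for i
    unfolding g_def using smooth[OF that] L_pos by (rule convex_smooth_grad_borel_measurable)
  define U where "U z h = z - \<gamma> *\<^sub>R (\<Sum>i=1..m. Q (h i) (g i z))" for z h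
  have U: "(\<lambda>(z, h). U z h) \<in> measurable (borel \<Otimes>\<^sub>M (\<Pi>\<^sub>M i\<in>{1..m}. S)) borel"
  proof -
    have "(\<lambda>p. Q (snd p i) (g i (fst p))) \<in> borel_measurable (borel \<Otimes>\<^sub>M (\<Pi>\<^sub>M i\<in>{1..m}. S))"
      if i: "i \<in> {1..m}" for i
    proof -
      have "(\<lambda>p. (snd p i, g i (fst p)))
          \<in> measurable (borel \<Otimes>\<^sub>M (\<Pi>\<^sub>M i\<in>{1..m}. S)) (S \<Otimes>\<^sub>M borel)"
        using g_measurable[OF i] i
        by (intro measurable_Pair measurable_compose[OF measurable_fst]
            measurable_compose[OF measurable_snd] measurable_component_singleton) auto
      from measurable_compose[OF this, of "\<lambda>(s, v). Q s v" borel] show ?thesis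
        using quantizer by (simp add: unbiased_random_quantizer_def)
    qed
    then show ?thesis
      unfolding U_def case_prod_unfold
      by (intro borel_measurable_diff borel_measurable_scaleR borel_measurable_sum) auto
  qed
  have stepU: "x (Suc k) \<omega> = U (x k \<omega>) (\<lambda>i\<in>{1..m}. \<xi> k i \<omega>)" if "\<omega> \<in> space M" for k \<omega>
    using step[OF that, of k] by (simp add: U_def g_def)
  note x_measurable = iterate_indep_fresh_seed(1)[where N = borel, OF prob fresh _ U init stepU, simplified]
  note joint = iterate_indep_fresh_seed(2)[where N = borel, OF prob fresh _ U init stepU, simplified]
  have seed_measurable: "\<xi> k i \<in> measurable M S" if "i \<in> {1..m}" for k i
    using fresh that by (auto simp: fresh_seeds_def indep_vars_def)

  have one_step: "integrable M (\<lambda>\<omega>. (norm (x (Suc k) \<omega> - xstar))\<^sup>2) \<and>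
      (\<integral>\<omega>. (norm (x (Suc k) \<omega> - xstar))\<^sup>2 \<partial>M)
        \<le> (1 - \<mu> * \<gamma>) * (\<integral>\<omega>. (norm (x k \<omega> - xstar))\<^sup>2 \<partial>M) + \<gamma> / (\<theta> * L) * C"
    if x2: "integrable M (\<lambda>\<omega>. (norm (x k \<omega> - xstar))\<^sup>2)" for k
  proof -
    have g2: "integrable M (\<lambda>\<omega>. (norm (g i (x k \<omega>)))\<^sup>2)" if i: "i \<in> {1..m}" for i
    proof (rule Bochner_Integration.integrable_bound)
      show "integrable M (\<lambda>\<omega>. 2 * L\<^sup>2 * (norm (x k \<omega> - xstar))\<^sup>2 + 2 * (norm (g i xstar))\<^sup>2)"
        using x2 by simp
      show "(\<lambda>\<omega>. (norm (g i (x k \<omega>)))\<^sup>2) \<in> borel_measurable M"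
        using measurable_compose[OF x_measurable g_measurable[OF i]] by measurable
      have "(norm (g i z))\<^sup>2 \<le> 2 * L\<^sup>2 * (norm (z - xstar))\<^sup>2 + 2 * (norm (g i xstar))\<^sup>2" for z
      proof -
        have "norm (g i z) \<le> L * norm (z - xstar) + norm (g i xstar)"
          using norm_triangle_sub[of "g i z" "g i xstar"]
            convex_smooth_lipschitz_grad[OF smooth[OF i] L_pos, of z xstar]
          by (simp add: g_def)
        then have "(norm (g i z))\<^sup>2 \<le> (L * norm (z - xstar) + norm (g i xstar))\<^sup>2"
          by (intro power_mono) auto
        also have "\<dots> \<le> 2 * (L * norm (z - xstar))\<^sup>2 + 2 * (norm (g i xstar))\<^sup>2"
          using sum_squares_bound[of "L * norm (z - xstar)" "norm (g i xstar)"]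
          by (simp add: power2_sum)
        finally show ?thesis
          by (simp add: power_mult_distrib)
      qed
      then show "AE \<omega> in M. norm ((norm (g i (x k \<omega>)))\<^sup>2)
          \<le> norm (2 * L\<^sup>2 * (norm (x k \<omega> - xstar))\<^sup>2 + 2 * (norm (g i xstar))\<^sup>2)"
        by (auto intro!: AE_I2 order_trans[OF _ abs_ge_self])
    qed
    note descent = sparse_quantized_step[where X = "x k" and X' = "x (Suc k)" and Z = "\<xi> k" and g = g
        and a = a and c = xstar, OF prob quantizer x_measurable x_measurable seed_measurable joint
        g_measurable _ spread less_imp_le[OF sigma_pos] g2 x2 step[of _ k, folded g_def]]
    have supp_g: "supp (g i z) \<subseteq> supp (a i)" if "i \<in> {1..m}" for i z
      using supp_grad[OF that] by (simp add: g_def)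
    have pointwise: "(norm (z - xstar))\<^sup>2 - 2 * \<gamma> * (\<Sum>i=1..m. g i z \<bullet> (z - xstar))
        + \<gamma>\<^sup>2 * \<sigma> * \<alpha> * (\<Sum>i=1..m. (norm (g i z))\<^sup>2)
        \<le> (1 - \<mu> * \<gamma>) * (norm (z - xstar))\<^sup>2 + \<gamma> / (\<theta> * L) * C" for z
    proof -
      let ?p = "G z \<bullet> (z - xstar)"
      have "\<gamma>\<^sup>2 * \<sigma> * \<alpha> * (\<Sum>i=1..m. (norm (g i z))\<^sup>2)
          \<le> \<gamma>\<^sup>2 * \<sigma> * \<alpha> * ((1 + \<theta>) * L * ?p + (1 + 1 / \<theta>) * C)"
        using sum_norm_squared_grad_le[of "{1..m}" L F \<theta> xstar z] smooth L_pos theta_pos stationary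
          sigma_pos alpha_ge_1
        by (intro mult_left_mono) (auto simp: C_def G_def g_def inner_sum_left)
      also have "\<dots> = \<gamma> * (\<gamma> * \<sigma> * \<alpha> * ((1 + \<theta>) * L)) * (?p + C / (\<theta> * L))"
        using theta_pos L_pos by (simp add: field_simps power2_eq_square)
      also have "\<dots> = \<gamma> * ?p + \<gamma> / (\<theta> * L) * C"
        unfolding gamma_eq by (simp add: algebra_simps)
      finally have "\<gamma>\<^sup>2 * \<sigma> * \<alpha> * (\<Sum>i=1..m. (norm (g i z))\<^sup>2) \<le> \<gamma> * ?p + \<gamma> / (\<theta> * L) * C" .
      moreover have "\<gamma> * (\<mu> * (norm (z - xstar))\<^sup>2) \<le> \<gamma> * ?p"
        using monotone gamma_pos by (intro mult_left_mono) auto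
      moreover have sum_eq: "(\<Sum>i=1..m. g i z \<bullet> (z - xstar)) = ?p"
        by (simp add: G_def inner_sum_left)
      ultimately show ?thesis
        unfolding sum_eq by (simp add: algebra_simps)
    qed
    have next_integrable: "integrable M (\<lambda>\<omega>. (norm (x (Suc k) \<omega> - xstar))\<^sup>2)"
      by (rule descent(1)) (use supp_g in auto)
    have "(\<integral>\<omega>. (norm (x (Suc k) \<omega> - xstar))\<^sup>2 \<partial>M)
        \<le> (\<integral>\<omega>. (1 - \<mu> * \<gamma>) * (norm (x k \<omega> - xstar))\<^sup>2 + \<gamma> / (\<theta> * L) * C \<partial>M)"
      by (rule order_trans[OF descent(3) integral_mono[OF descent(2)]])
        (use supp_g x2 pointwise in auto)
    also have "\<dots> = (1 - \<mu> * \<gamma>) * (\<integral>\<omega>. (norm (x k \<omega> - xstar))\<^sup>2 \<partial>M) + \<gamma> / (\<theta> * L) * C"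
      using x2 by (simp add: prob_space)
    finally show ?thesis
      using next_integrable by blast
  qed

  have "integrable M (\<lambda>\<omega>. (norm (x k \<omega> - xstar))\<^sup>2) \<and>
      (\<integral>\<omega>. (norm (x k \<omega> - xstar))\<^sup>2 \<partial>M)
        \<le> (1 - \<mu> * \<gamma>) ^ k * (norm (x0 - xstar))\<^sup>2 + 1 / (\<mu> * \<theta> * L) * C" for k
  proof (induction k)
    case 0
    have "integrable M (\<lambda>\<omega>. (norm (x 0 \<omega> - xstar))\<^sup>2)"
      by (subst Bochner_Integration.integrable_cong[OF refl, of _ _ "\<lambda>_. (norm (x0 - xstar))\<^sup>2"])
        (auto simp: init)
    moreover have "(\<integral>\<omega>. (norm (x 0 \<omega> - xstar))\<^sup>2 \<partial>M) = (norm (x0 - xstar))\<^sup>2"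
      by (subst Bochner_Integration.integral_cong[OF refl, of _ _ "\<lambda>_. (norm (x0 - xstar))\<^sup>2"])
        (auto simp: init prob_space)
    moreover have "0 \<le> 1 / (\<mu> * \<theta> * L) * C"
      using mu_pos theta_pos L_pos by (simp add: C_def sum_nonneg)
    ultimately show ?case
      by simp
  next
    case (Suc k)
    let ?D = "(norm (x0 - xstar))\<^sup>2"
    have "(\<integral>\<omega>. (norm (x (Suc k) \<omega> - xstar))\<^sup>2 \<partial>M)
        \<le> (1 - \<mu> * \<gamma>) * (\<integral>\<omega>. (norm (x k \<omega> - xstar))\<^sup>2 \<partial>M) + \<gamma> / (\<theta> * L) * C"
      using one_step Suc by blast
    also have "\<dots> \<le> (1 - \<mu> * \<gamma>) * ((1 - \<mu> * \<gamma>) ^ k * ?D + 1 / (\<mu> * \<theta> * L) * C) + \<gamma> / (\<theta> * L) * C"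
      using Suc contraction by (intro add_right_mono mult_left_mono) auto
    also have "\<dots> = (1 - \<mu> * \<gamma>) ^ Suc k * ?D + 1 / (\<mu> * \<theta> * L) * C"
      using mu_pos theta_pos L_pos by (simp add: field_simps)
    finally show ?case
      using one_step Suc by blast
  qed
  then show ?thesis
    by (simp only: C_def g_def simp_thms)
qed

end
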